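(* Let $\varepsilon>0$. Let $q$ be a prime such that $r=2q+1$ is also prime (i.e. $q$ is a Sophie Germain prime), and suppose $q+1$ has an odd prime divisor $p$ with $p>q^{1-\varepsilon}$. Put $n=pqr$. Then $J_n<10\,n^{1/(3-\varepsilon)}$.
   Context: For a positive integer $n$, the $n$th cyclotomic polynomial is $\Phi_n(x)=\prod_{1\le m\le n,\ \gcd(m,n)=1}(x-e^{2\pi i m/n})=\sum_{k\in\mathbb{Z}}a_n(k)x^k$, where $a_n(k)=0$ for $k<0$ and for $k>\varphi(n)$. A coefficient $a_n(k)$ is called jumping up if $a_n(k)=a_n(k-1)+1$. $J_n$ denotes the number of integers $k$ for which $a_n(k)$ is jumping up.
   Formalization: The restriction ε < 3 is added: at ε = 3 the exponent 1/(3-ε) is undefined, and for ε > 3 the claim fails, e.g. q = 2, p = 3, r = 5, n = 30, ε = 4, where J_30 = 3 but the bound is 1/3. *)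

theory Defs
  imports "HOL-Analysis.Analysis" "HOL-Computational_Algebra.Polynomial"
begin

definition cyclotomic_poly :: "nat \<Rightarrow> complex poly" where
  "cyclotomic_poly n =
     (\<Prod>m | 1 \<le> m \<and> m \<le> n \<and> coprime m n.
        [:- exp (2 * of_real pi * \<i> * of_nat m / of_nat n), 1:])"

(* Indexed by all integers and zero-extended to the left, so that the comparison of
   the coefficient at 0 with its predecessor is meaningful; to the right of the degree
   coeff is already 0. The coefficients are integers, but are kept as complex numbers. *)
definition cyclotomic_coeff :: "nat \<Rightarrow> int \<Rightarrow> complex" where
  "cyclotomic_coeff n k = (if k < 0 then 0 else coeff (cyclotomic_poly n) (nat k))"

definition jumping_up :: "nat \<Rightarrow> int \<Rightarrow> bool" where
  "jumping_up n k \<longleftrightarrow> cyclotomic_coeff n k = cyclotomic_coeff n (k - 1) + 1"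

(* For n > 0 the set is finite, since a jump requires one of the two coefficients to be
   nonzero; hence card is the true number of jumps. *)
definition num_jumps_up :: "nat \<Rightarrow> nat" where
  "num_jumps_up n = card {k. jumping_up n k}"

end

theory Submission
  imports Defs
begin

text \<open>
  Put \<open>s = (q + 1) / p\<close>, \<open>u = x\<^bsup>qr\<^esup>\<close>, \<open>v = x\<^bsup>pr\<^esup>\<close>, \<open>w = x\<^bsup>pq\<^esup>\<close>. The hypotheses on
  \<open>p\<close>, \<open>q\<close>, \<open>r\<close> say exactly that \<open>x\<^sup>p = v / w\<^sup>2\<close>, \<open>x\<^sup>q = w\<^bsup>2s\<^esup> / u\<close> and \<open>x\<^sup>r = v\<^sup>s / u\<close>. Hence in
  \<open>(1 - x) \<Phi>\<^sub>n(x) = (1 - x\<^sup>n)(1 - x\<^sup>p)(1 - x\<^sup>q)(1 - x\<^sup>r) / ((1 - u)(1 - v)(1 - w))\<close>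
  a partial fraction expansion cancels the denominators by geometric sums, and
  \<open>(1 - x) \<Phi>\<^sub>n(x)\<close> becomes a signed sum of monomials of which only \<open>8q + 5\<close> carry a plus sign.
  The jumps up are the coefficients \<open>1\<close> of this polynomial, so there are at most \<open>8q + 5\<close> of
  them, whereas \<open>n > 2 q\<^bsup>3 - \<epsilon>\<^esup>\<close>.
\<close>

section \<open>Counting the nonzero terms of a polynomial\<close>

definition num_terms :: "'a::zero poly \<Rightarrow> nat" where
  "num_terms f = card {k. coeff f k \<noteq> 0}"

lemma finite_coeff_support: "finite {k. coeff f k \<noteq> 0}"
  using MOST_coeff_eq_0[of f] by (simp add: eventually_cofinite)

lemma num_terms_add: "num_terms (f + g) \<le> num_terms f + num_terms g"
proof -
  have "num_terms (f + g) \<le> card ({k. coeff f k \<noteq> 0} \<union> {k. coeff g k \<noteq> 0})"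
    unfolding num_terms_def by (intro card_mono) (auto simp: finite_coeff_support)
  also have "\<dots> \<le> num_terms f + num_terms g"
    unfolding num_terms_def by (rule card_Un_le)
  finally show ?thesis .
qed

lemma num_terms_mult:
  fixes f g :: "'a::comm_semiring_0 poly"
  shows "num_terms (f * g) \<le> num_terms f * num_terms g"
proof -
  let ?S = "{k. coeff f k \<noteq> 0} \<times> {k. coeff g k \<noteq> 0}"
  have fin: "finite ?S" by (intro finite_cartesian_product finite_coeff_support)
  have "{k. coeff (f * g) k \<noteq> 0} \<subseteq> (\<lambda>(i, j). i + j) ` ?S"
  proof
    fix k assume "k \<in> {k. coeff (f * g) k \<noteq> 0}"
    then have "(\<Sum>i\<le>k. coeff f i * coeff g (k - i)) \<noteq> 0"
      by (simp add: coeff_mult)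
    then obtain i where i: "i \<le> k" "coeff f i * coeff g (k - i) \<noteq> 0"
      by (meson atMost_iff sum.neutral)
    then have "coeff f i \<noteq> 0" "coeff g (k - i) \<noteq> 0" by auto
    with i(1) show "k \<in> (\<lambda>(i, j). i + j) ` ?S"
      by (intro image_eqI[of _ _ "(i, k - i)"]) auto
  qed
  then have "num_terms (f * g) \<le> card ((\<lambda>(i, j). i + j) ` ?S)"
    unfolding num_terms_def using fin by (intro card_mono) auto
  also have "\<dots> \<le> card ?S" using fin by (rule card_image_le)
  finally show ?thesis by (simp add: num_terms_def card_cartesian_product)
qed

lemma num_terms_monom: "num_terms (monom c k) \<le> 1"
proof -
  have "{j. coeff (monom c k) j \<noteq> 0} \<subseteq> {k}" by auto
  then show ?thesis unfolding num_terms_def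
    using card_mono[of "{k}"] by fastforce
qed

lemma num_terms_monom_mult:
  fixes f :: "'a::comm_semiring_0 poly"
  shows "num_terms (monom c k * f) \<le> num_terms f"
  using order_trans[OF num_terms_mult mult_le_mono1[OF num_terms_monom]] by (simp only: mult_1)

text \<open>Exponents are written \<open>d * i\<close> to match what \<open>monom_power\<close>
  makes of \<open>monom 1 d ^ i\<close>.\<close>

lemma num_terms_geometric: "num_terms (\<Sum>i<m. monom (1::'a::comm_semiring_1) (d * i)) \<le> m"
proof (induction m)
  case 0
  then show ?case by (simp add: num_terms_def)
next
  case (Suc m)
  then show ?case
    using num_terms_add[of "\<Sum>i<m. monom 1 (d * i)" "monom (1::'a) (d * m)"]
      num_terms_monom[of "1::'a" "d * m"]
    by simp
qed

section \<open>Natural coefficients and the count of coefficients equal to 1\<close>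

text \<open>Stands in for nonnegative integer coefficients, as the polynomials in question are over
  the complex numbers.\<close>

definition nat_poly :: "'a::semiring_1 poly \<Rightarrow> bool" where
  "nat_poly f \<longleftrightarrow> (\<forall>k. coeff f k \<in> \<nat>)"

lemma sum_in_Nats: "(\<And>i. i \<in> I \<Longrightarrow> f i \<in> \<nat>) \<Longrightarrow> sum f I \<in> \<nat>"
  by (induction I rule: infinite_finite_induct) auto

lemma nat_poly_add: "nat_poly f \<Longrightarrow> nat_poly g \<Longrightarrow> nat_poly (f + g)"
  by (auto simp: nat_poly_def)

lemma nat_poly_mult:
  fixes f g :: "'a::comm_semiring_1 poly"
  shows "nat_poly f \<Longrightarrow> nat_poly g \<Longrightarrow> nat_poly (f * g)"
  by (auto simp: nat_poly_def coeff_mult intro!: sum_in_Nats)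

lemma nat_poly_monom: "nat_poly (monom 1 k)"
  by (auto simp: nat_poly_def)

lemma nat_poly_geometric: "nat_poly (\<Sum>i<m. monom (1::'a::comm_semiring_1) (d * i))"
  by (auto simp: nat_poly_def coeff_sum intro!: sum_in_Nats)

text \<open>Where \<open>A\<close> has no term, the coefficient of \<open>f\<close> is minus a
  natural number, which is not 1 in characteristic 0. So every coefficient 1 of \<open>f\<close>
  lies, after the shift by \<open>c\<close>, over a term of \<open>A\<close>.\<close>

lemma card_coeff_eq_1_le:
  fixes A B :: "'a::{comm_ring_1, ring_char_0} poly"
  assumes "nat_poly B" "monom 1 c * f = A - B"
  shows "card {k. coeff f k = 1} \<le> num_terms A"
  unfolding num_terms_def
proof (rule card_inj_on_le[where f = "\<lambda>k. k + c"])
  show "(\<lambda>k. k + c) ` {k. coeff f k = 1} \<subseteq> {k. coeff A k \<noteq> 0}"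
  proof clarsimp
    fix k assume k: "coeff f k = 1" "coeff A (k + c) = 0"
    obtain m where "coeff B (k + c) = of_nat m"
      using assms(1) unfolding nat_poly_def by (meson Nats_cases)
    moreover have "coeff f k = coeff A (k + c) - coeff B (k + c)"
      using arg_cong[OF assms(2), of "\<lambda>g. coeff g (k + c)"]
      by (simp add: coeff_monom_mult)
    ultimately have "of_nat (Suc m) = (0::'a)" using k by (simp add: algebra_simps)
    then show False using of_nat_eq_0_iff by blast
  qed
qed (auto simp: finite_coeff_support)

text \<open>Multiplying by 1 - x takes differences of consecutive coefficients. At a negative index
  both coefficients are 0, so no jump is lost by passing to natural exponents.\<close>

lemma num_jumps_up_eq_card:
  "num_jumps_up n = card {k. coeff ([:1, -1:] * cyclotomic_poly n) k = 1}"
proof -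
  have coeff: "coeff ([:1, -1:] * cyclotomic_poly n) k
      = cyclotomic_coeff n (int k) - cyclotomic_coeff n (int k - 1)" for k
    by (cases k) (auto simp: cyclotomic_coeff_def nat_add_distrib)
  have nonneg: "0 \<le> k" if "cyclotomic_coeff n k = 1 + cyclotomic_coeff n (k - 1)" for k
    using that by (auto simp: cyclotomic_coeff_def split: if_splits)
  have "bij_betw int {k. coeff ([:1, -1:] * cyclotomic_poly n) k = 1} {k. jumping_up n k}"
    unfolding coeff
    by (rule bij_betw_byWitness[where f' = nat])
      (auto simp: jumping_up_def diff_eq_eq add.commute dest: nonneg)
  then show ?thesis unfolding num_jumps_up_def by (rule bij_betw_same_card[symmetric])
qed

section \<open>Factorization of the cyclotomic polynomial for three primes\<close>

abbreviation cyc_factor :: "nat \<Rightarrow> nat \<Rightarrow> complex poly" where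
  "cyc_factor n m \<equiv> [:- exp (2 * of_real pi * \<i> * of_nat m / of_nat n), 1:]"

text \<open>Both sides are monic of degree n and agree at the n roots of unity; equal leading
  coefficients make n points enough.\<close>

lemma prod_cyc_factor:
  assumes "n > 0"
  shows "(\<Prod>m\<in>{1..n}. cyc_factor n m) = monom 1 n - 1"
proof (rule poly_eqI_degree_lead_coeff[where n = n and A = "{z. z ^ n = 1}"])
  have deg: "degree (\<Prod>m\<in>{1..n}. cyc_factor n m) = n"
    by (subst degree_prod_eq_sum_degree) auto
  then have "coeff (\<Prod>m\<in>{1..n}. cyc_factor n m) n = 1"
    using lead_coeff_prod[of "cyc_factor n" "{1..n}"] by simp
  then show "coeff (\<Prod>m\<in>{1..n}. cyc_factor n m) n = coeff (monom 1 n - 1) n"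
    using assms by (simp add: coeff_1)
  show "degree (\<Prod>m\<in>{1..n}. cyc_factor n m) \<le> n" using deg by simp
  show "degree (monom 1 n - 1 :: complex poly) \<le> n"
    by (intro degree_diff_le) (auto simp: degree_monom_le)
  show "n \<le> card {z::complex. z ^ n = 1}"
    using card_roots_unity_eq[OF assms] by simp
next
  fix z :: complex assume "z \<in> {z. z ^ n = 1}"
  then have z: "z ^ n = 1" by simp
  then obtain j where j: "j < n" "z = exp (2 * of_real pi * \<i> * of_nat j / of_nat n)"
    using complex_roots_unity[of n] assms by auto
  \<comment> \<open>The roots come indexed from 0 to n - 1, the product from 1 to n: the root 1
    moves from index 0 to n.\<close>
  have "\<exists>m\<in>{1..n}. z = exp (2 * of_real pi * \<i> * of_nat m / of_nat n)"
  proof (cases "j = 0")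
    case True
    then show ?thesis using j assms by (intro bexI[of _ n]) auto
  next
    case False
    then show ?thesis using j by (intro bexI[of _ j]) auto
  qed
  then have "poly (\<Prod>m\<in>{1..n}. cyc_factor n m) z = 0"
    by (auto simp: poly_prod)
  then show "poly (\<Prod>m\<in>{1..n}. cyc_factor n m) z = poly (monom 1 n - 1) z"
    using z by (simp add: poly_monom)
qed

text \<open>The roots with index m = d * j are the k-th roots of unity. The default factor 1 keeps
  the full index range, so that products for different d can be multiplied index by index.\<close>

lemma prod_cyc_factor_multiples:
  assumes "d > 0" "k > 0"
  shows "(\<Prod>m\<in>{1..d * k}. if d dvd m then cyc_factor (d * k) m else 1) = monom 1 k - 1"
proof -
  have "{m\<in>{1..d * k}. d dvd m} = (\<lambda>j. d * j) ` {1..k}"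
    using assms by (auto simp: dvd_def)
  then have "(\<Prod>m\<in>{1..d * k}. if d dvd m then cyc_factor (d * k) m else 1)
      = (\<Prod>m\<in>(\<lambda>j. d * j) ` {1..k}. cyc_factor (d * k) m)"
    using prod.inter_filter[of "{1..d * k}" "cyc_factor (d * k)" "(dvd) d"] by simp
  also have "\<dots> = (\<Prod>j\<in>{1..k}. cyc_factor (d * k) (d * j))"
    using assms by (subst prod.reindex) (auto simp: inj_on_def)
  also have "\<dots> = (\<Prod>j\<in>{1..k}. cyc_factor k j)"
    using assms by (intro prod.cong) (auto simp: field_simps)
  finally show ?thesis using prod_cyc_factor[OF assms(2)] by simp
qed

text \<open>Inclusion-exclusion over the divisibility of \<open>m\<close> by \<open>p\<close>, \<open>q\<close> and \<open>r\<close>, read off factor by factor.\<close>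

lemma cyclotomic_poly_ternary:
  assumes primes: "prime p" "prime q" "prime r" and distinct: "p \<noteq> q" "p \<noteq> r" "q \<noteq> r"
  shows "cyclotomic_poly (p * q * r) * (monom 1 1 - 1)
      * (monom 1 (q * r) - 1) * (monom 1 (p * r) - 1) * (monom 1 (p * q) - 1)
    = (monom 1 (p * q * r) - 1) * (monom 1 p - 1) * (monom 1 q - 1) * (monom 1 r - 1)"
proof -
  define n where "n = p * q * r"
  have pos: "p > 0" "q > 0" "r > 0" using primes by (auto simp: prime_gt_0_nat)
  define F where "F d = (\<Prod>m\<in>{1..n}. if d dvd m then cyc_factor n m else 1)" for d
  have F: "F d = monom 1 k - 1" if "n = d * k" for d k
    using prod_cyc_factor_multiples[of d k] that pos unfolding F_def n_def
    by (metis mult_pos_pos nat_0_less_mult_iff)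
  have Phi: "cyclotomic_poly n = (\<Prod>m\<in>{1..n}. if coprime m n then cyc_factor n m else 1)"
    unfolding cyclotomic_poly_def prod.inter_filter[symmetric, OF finite_atLeastAtMost]
    by (intro prod.cong) auto
  have cop: "coprime m n \<longleftrightarrow> \<not> p dvd m \<and> \<not> q dvd m \<and> \<not> r dvd m" for m
    unfolding n_def using primes
    by (auto simp: coprime_mult_right_iff prime_imp_coprime coprime_commute
        dest: prime_imp_coprime_nat)
  have cop2: "coprime p q" "coprime p r" "coprime q r"
    using primes distinct by (auto simp: primes_coprime)
  have pq: "p * q dvd m \<longleftrightarrow> p dvd m \<and> q dvd m"
    and pr: "p * r dvd m \<longleftrightarrow> p dvd m \<and> r dvd m"
    and qr: "q * r dvd m \<longleftrightarrow> q dvd m \<and> r dvd m" for m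
    using cop2 by (auto intro: divides_mult dvd_mult_left dvd_mult_right)
  have pqr: "n dvd m \<longleftrightarrow> p dvd m \<and> q dvd m \<and> r dvd m" for m
    unfolding n_def using cop2 by (auto intro!: divides_mult intro: dvd_mult_left dvd_mult_right)
  \<comment> \<open>If t of the three primes divide m, its factor occurs [t = 0] + [t = 3] + t times
    on the left and 1 + t(t - 1)/2 times on the right. These agree for t = 0, 1, 2, 3.\<close>
  have "cyclotomic_poly n * F n * F p * F q * F r = F 1 * F (q * r) * F (p * r) * F (p * q)"
    unfolding Phi F_def prod.distrib[symmetric]
    by (intro prod.cong refl) (auto simp: cop pq pr qr pqr)
  then show ?thesis
    using F[of n 1] F[of p "q * r"] F[of q "p * r"] F[of r "p * q"]
      F[of 1 n] F[of "q * r" p] F[of "p * r" q] F[of "p * q" r]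
    by (simp add: n_def mult_ac)
qed

section \<open>The partial fraction expansion\<close>

text \<open>By \<open>rel\<close>, the numerator times \<open>u\<^sup>2 * w\<^sup>2\<close> is (1 -
  y)(w^2 - v)(u - W)(u - V). Splitting w^2 - v = w^2 (1 - v) - v (1 + w)(1 - w) cancels one
  denominator in each part, and u - W = (1 - W) - (1 - u), likewise for V, turns the rest into
  geometric sums.\<close>

lemma partial_fraction_identity:
  fixes P u v w y xp xq xr U V W :: "'a::idom"
  assumes P: "P * ((1 - u) * (1 - v) * (1 - w)) = (1 - y) * (1 - xp) * (1 - xq) * (1 - xr)"
    and rel: "xp * w\<^sup>2 = v" "xq * u = W" "xr * u = V"
    and nz: "u \<noteq> 1" "v \<noteq> 1" "w \<noteq> 1"
    and sums: "S\<^sub>u * (1 - u) = 1 - y" "S\<^sub>v * (1 - v) = 1 - y" "S\<^sub>w * (1 - w) = 1 - y"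
      "T\<^sub>v * (1 - v) = 1 - V" "T\<^sub>w * (1 - w) = 1 - W"
  shows "u\<^sup>2 * w\<^sup>2 * P = w\<^sup>2 * (u - V) * (T\<^sub>w * S\<^sub>u - S\<^sub>w) - v * (1 + w) * (u - W) * (T\<^sub>v * S\<^sub>u - S\<^sub>v)"
    (is "_ = ?R")
proof -
  let ?D = "(1 - u) * (1 - v) * (1 - w)"
  have "(T\<^sub>w * S\<^sub>u - S\<^sub>w) * ((1 - u) * (1 - w))
      = (T\<^sub>w * (1 - w)) * (S\<^sub>u * (1 - u)) - (S\<^sub>w * (1 - w)) * (1 - u)"
    by (simp add: algebra_simps)
  also have "\<dots> = (1 - y) * (u - W)"
    unfolding sums by (simp add: algebra_simps)
  finally have E\<^sub>w: "(T\<^sub>w * S\<^sub>u - S\<^sub>w) * ((1 - u) * (1 - w)) = (1 - y) * (u - W)" .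
  have "(T\<^sub>v * S\<^sub>u - S\<^sub>v) * ((1 - u) * (1 - v))
      = (T\<^sub>v * (1 - v)) * (S\<^sub>u * (1 - u)) - (S\<^sub>v * (1 - v)) * (1 - u)"
    by (simp add: algebra_simps)
  also have "\<dots> = (1 - y) * (u - V)"
    unfolding sums by (simp add: algebra_simps)
  finally have E\<^sub>v: "(T\<^sub>v * S\<^sub>u - S\<^sub>v) * ((1 - u) * (1 - v)) = (1 - y) * (u - V)" .
  have regroup: "(X * a - Y * b) * (c * d * e) = X * d * (a * (c * e)) - Y * e * (b * (c * d))"
    for X Y a b c d e :: 'a
    by (simp add: algebra_simps)
  have "?R * ?D = w\<^sup>2 * (u - V) * (1 - v) * ((T\<^sub>w * S\<^sub>u - S\<^sub>w) * ((1 - u) * (1 - w)))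
      - v * (1 + w) * (u - W) * (1 - w) * ((T\<^sub>v * S\<^sub>u - S\<^sub>v) * ((1 - u) * (1 - v)))"
    by (rule regroup)
  also have "\<dots> = (1 - y) * (w\<^sup>2 - v) * (u - W) * (u - V)"
    unfolding E\<^sub>w E\<^sub>v by (simp add: algebra_simps power2_eq_square)
  also have "\<dots> = (1 - y) * (w\<^sup>2 - xp * w\<^sup>2) * (u - xq * u) * (u - xr * u)"
    by (simp only: rel)
  also have "\<dots> = u\<^sup>2 * w\<^sup>2 * ((1 - y) * (1 - xp) * (1 - xq) * (1 - xr))"
    by (simp add: algebra_simps power2_eq_square)
  also have "\<dots> = (u\<^sup>2 * w\<^sup>2 * P) * ?D"
    unfolding P[symmetric] by (simp only: mult_ac)
  finally have "(u\<^sup>2 * w\<^sup>2 * P) * ?D = ?R * ?D" by (rule sym)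
  moreover have "?D \<noteq> 0" using nz by simp
  ultimately show ?thesis using mult_right_cancel by blast
qed

section \<open>The linear bound in q\<close>

lemma num_jumps_up_le:
  assumes primes: "prime p" "prime q" "prime r"
    and s: "q + 1 = p * s" and r: "r = 2 * q + 1"
  shows "num_jumps_up (p * q * r) \<le> 8 * q + 5"
proof -
  define n where "n = p * q * r"
  define x u v w :: "complex poly"
    where "x = monom 1 1" and "u = monom 1 (q * r)" and "v = monom 1 (p * r)" and "w = monom 1 (p * q)"
  note defs = x_def u_def v_def w_def
  have pos: "p > 1" "q > 1" "r > 1" using primes prime_gt_1_nat by auto
  \<comment> \<open>If p = q, then p would divide 1; and p = r is excluded by p \<le> q + 1 <
    r.\<close>
  have "p \<noteq> q"
    using s pos by (metis One_nat_def dvd_add_right_iff dvd_refl dvd_triv_left nat_dvd_1_iff_1 nat_neq_iff)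
  moreover have "p \<le> q + 1" using s by (metis dvd_imp_le dvd_triv_left add_gr_0 zero_less_one)
  ultimately have distinct: "p \<noteq> q" "p \<noteq> r" "q \<noteq> r" using r pos by auto

  define P where "P = [:1, -1:] * cyclotomic_poly n"
  have x': "[:1, -1:] = 1 - x" by (simp add: x_def monom_altdef one_pCons)
  \<comment> \<open>Four factors change sign on each side, so the signs cancel.\<close>
  have P: "P * ((1 - u) * (1 - v) * (1 - w))
      = (1 - monom 1 n) * (1 - monom 1 p) * (1 - monom 1 q) * (1 - monom 1 r)"
    using cyclotomic_poly_ternary[OF primes distinct]
    unfolding P_def x' defs n_def by (simp only: algebra_simps)
  have rel: "monom 1 p * w\<^sup>2 = v" "monom 1 q * u = w ^ (2 * s)" "monom 1 r * u = v ^ s"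
  proof -
    have "p + p * q * 2 = p * r" using r by simp
    moreover have "q + q * r = q * 2 * (q + 1)" using r by simp
    then have "q + q * r = p * q * (2 * s)" unfolding s by (simp add: mult_ac)
    moreover have "r + q * r = r * (q + 1)" by simp
    then have "r + q * r = p * r * s" unfolding s by (simp add: mult_ac)
    ultimately show "monom 1 p * w\<^sup>2 = v" "monom 1 q * u = w ^ (2 * s)" "monom 1 r * u = v ^ s"
      by (simp_all add: defs mult_monom monom_power)
  qed
  have nz: "u \<noteq> 1" "v \<noteq> 1" "w \<noteq> 1"
    using pos by (auto simp: defs monom_eq_1_iff)
  have geo: "(\<Sum>i<m. z ^ i) * (1 - z) = 1 - z ^ m" for z :: "complex poly" and m
    by (simp add: one_diff_power_eq mult.commute)
  have y: "u ^ p = monom 1 n" "v ^ q = monom 1 n" "w ^ r = monom 1 n"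
    by (simp_all add: defs n_def monom_power mult_ac)

  \<comment> \<open>The lengths of the \<open>S\<close> sums make each telescope to 1 - x^n; those
    of the \<open>T\<close> sums stop at \<open>v ^ s\<close> and \<open>w ^ (2 * s)\<close>, the V
    and W of the expansion.\<close>
  define S\<^sub>u S\<^sub>v S\<^sub>w T\<^sub>v T\<^sub>w where "S\<^sub>u = (\<Sum>i<p. u ^ i)" and "S\<^sub>v = (\<Sum>i<q. v ^ i)" and "S\<^sub>w = (\<Sum>i<r. w ^ i)"
    and "T\<^sub>v = (\<Sum>i<s. v ^ i)" and "T\<^sub>w = (\<Sum>i<2 * s. w ^ i)"
  note sum_defs = S\<^sub>u_def S\<^sub>v_def S\<^sub>w_def T\<^sub>v_def T\<^sub>w_def
  \<comment> \<open>\<open>A\<close> and \<open>B\<close> collect the products with plus and minus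
    sign in the expanded identity.\<close>
  define A where "A = w\<^sup>2 * (u * (T\<^sub>w * S\<^sub>u) + v ^ s * S\<^sub>w)
     + (v + v * w) * (u * S\<^sub>v + w ^ (2 * s) * (T\<^sub>v * S\<^sub>u))"
  define B where "B = w\<^sup>2 * (v ^ s * (T\<^sub>w * S\<^sub>u) + u * S\<^sub>w)
     + (v + v * w) * (w ^ (2 * s) * S\<^sub>v + u * (T\<^sub>v * S\<^sub>u))"
  have "u\<^sup>2 * w\<^sup>2 * P = w\<^sup>2 * (u - v ^ s) * (T\<^sub>w * S\<^sub>u - S\<^sub>w)
      - v * (1 + w) * (u - w ^ (2 * s)) * (T\<^sub>v * S\<^sub>u - S\<^sub>v)"
    by (rule partial_fraction_identity[OF P rel nz]) (simp_all only: sum_defs geo y)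
  also have "\<dots> = A - B"
    unfolding A_def B_def by (simp add: algebra_simps)
  finally have AB: "monom 1 (q * r * 2 + p * q * 2) * P = A - B"
    by (simp add: defs mult_monom monom_power)

  have "nat_poly B"
    unfolding B_def sum_defs defs monom_power power_one mult_monom mult_1
    by (intro nat_poly_add nat_poly_mult nat_poly_monom nat_poly_geometric)
  then have "num_jumps_up n \<le> num_terms A"
    unfolding num_jumps_up_eq_card P_def[symmetric] using AB by (rule card_coeff_eq_1_le)
  also have "num_terms A \<le> 8 * q + 5"
  proof -
    have prod: "num_terms (f * g) \<le> a * b"
      if "num_terms f \<le> a" "num_terms g \<le> b" for f g :: "complex poly" and a b
      using num_terms_mult[of f g] mult_le_mono[OF that] by simp
    have plus: "num_terms (f + g) \<le> a + b"
      if "num_terms f \<le> a" "num_terms g \<le> b" for f g :: "complex poly" and a b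
      using num_terms_add[of f g] that by simp
    have one: "num_terms (f * g) \<le> b"
      if "f \<in> range (monom 1)" "num_terms g \<le> b" for f g :: "complex poly" and b
      using that num_terms_monom_mult by (auto intro: order_trans)
    \<comment> \<open>Monomial factors cost nothing, \<open>v + v * w\<close> costs a factor 2, and
      each geometric sum counts its length. With s * p = q + 1 this is 2(q + 1) + (2q + 1) + 2(2q +
      1).\<close>
    have "num_terms A \<le> (2 * s * p + r) + (1 + 1) * (q + s * p)"
      unfolding A_def
      by (intro plus prod one)
        (auto simp: sum_defs defs monom_power mult_monom num_terms_geometric
          intro: num_terms_monom[of 1, unfolded One_nat_def])
    also have "\<dots> = 8 * q + 5"
      using r s by (simp add: algebra_simps)
    finally show ?thesis .
  qed
  finally show ?thesis by (simp add: n_def)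
qed

theorem theorem1p3:
  fixes \<epsilon> :: real and p q r n :: nat
  assumes "0 < \<epsilon>" and "\<epsilon> < 3"
    and "prime q" and "r = 2 * q + 1" and "prime r"
    and "prime p" and "odd p" and "p dvd q + 1"
    and "real p > real q powr (1 - \<epsilon>)"
    and "n = p * q * r"
  shows "real (num_jumps_up n) < 10 * real n powr (1 / (3 - \<epsilon>))"
proof -
  obtain s where s: "q + 1 = p * s" using \<open>p dvd q + 1\<close> by (elim dvdE)
  have q: "2 \<le> q" using \<open>prime q\<close> by (rule prime_ge_2_nat)
  \<comment> \<open>The constant 5/4 satisfies (5/4)^3 = 125/64 < 2, and 8q + 5 \<le> 10 * (5/4) * q
    holds for q \<ge> 2.\<close>
  have "((5 / 4) * real q) powr (3 - \<epsilon>) = (5 / 4) powr (3 - \<epsilon>) * real q powr (3 - \<epsilon>)"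
    by (subst powr_mult) auto
  also have "\<dots> \<le> 2 * real q powr (3 - \<epsilon>)"
  proof (rule mult_right_mono)
    have "(5 / 4) powr (3 - \<epsilon>) \<le> (5 / 4 :: real) powr 3"
      using \<open>0 < \<epsilon>\<close> by (intro powr_mono) auto
    then show "(5 / 4) powr (3 - \<epsilon>) \<le> (2 :: real)" by (simp add: power3_eq_cube)
  qed simp
  also have "\<dots> = real q powr (1 - \<epsilon>) * (2 * real q ^ 2)"
    using q powr_add[of "real q" "1 - \<epsilon>" 2] by (simp add: algebra_simps)
  also have "\<dots> < real p * (2 * real q ^ 2)"
    using \<open>real p > real q powr (1 - \<epsilon>)\<close> q by (intro mult_strict_right_mono) auto
  also have "\<dots> \<le> real n"
    unfolding \<open>n = p * q * r\<close> \<open>r = 2 * q + 1\<close> by (simp add: algebra_simps power2_eq_square)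
  finally have "(5 / 4) * real q < real n powr (1 / (3 - \<epsilon>))"
    using \<open>\<epsilon> < 3\<close> q powr_less_mono2[of "1 / (3 - \<epsilon>)" "((5 / 4) * real q) powr (3 - \<epsilon>)" "real n"]
    by (simp add: powr_powr)
  moreover have "num_jumps_up n \<le> 8 * q + 5"
    unfolding \<open>n = p * q * r\<close>
    by (intro num_jumps_up_le[where s = s]) (use assms s in auto)
  ultimately show ?thesis using q by linarith
qed

end
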